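(* Let $M\in SL(N,\mathbb Z)$ be a matrix of type $\mathcal J$. Then there exists a Dirichlet family of polynomials for $M$.
   Context: An integer polynomial $C$ is of type $\mathcal J$ if $C=B_0B_1\cdots B_k$ with $k\ge1$, $B_i\in\mathbb Z[t]$, where $B_0$ has no real roots; each $B_i$ ($i\ge1$) is irreducible with at least one real root and at least one non-real root; and for all $i\ne j$ ($i,j\ge0$) $B_i,B_j$ are strongly coprime: $(B_i)+(B_j)=\mathbb Z[t]$. $M$ is of type $\mathcal J$ if its characteristic polynomial is; denote its (simple) real eigenvalues by $\alpha_1,\dots,\alpha_s$. A Dirichlet family for $M$ is a family $(D_1,\dots,D_s)$ in $\mathbb Z[t]$ such that (D1) $D_i(M)\in SL(N,\mathbb Z)$ for all $i$; (D2) $D_i(\alpha_j)>0$ for all $i,j$; (D3) the vectors $(\log D_i(\alpha_1),\dots,\log D_i(\alpha_s))$, $1\le i\le s$, form a basis of $\mathbb R^s$. *)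

theory Defs
  imports "Jordan_Normal_Form.Char_Poly" "HOL-Computational_Algebra.Polynomial_Factorial"
begin

definition mat_poly_eval :: "'a::comm_ring_1 poly \<Rightarrow> 'a mat \<Rightarrow> 'a mat" where
  "mat_poly_eval p A =
     foldr (\<lambda>i B. coeff p i \<cdot>\<^sub>m (A ^\<^sub>m i) + B) [0..<Suc (degree p)]
           (0\<^sub>m (dim_row A) (dim_row A))"

definition strongly_coprime :: "int poly \<Rightarrow> int poly \<Rightarrow> bool" where
  "strongly_coprime P Q \<longleftrightarrow> (\<exists>u v. u * P + v * Q = 1)"

definition type_J_poly :: "int poly \<Rightarrow> bool" where
  "type_J_poly C \<longleftrightarrow> (\<exists>k::nat. \<exists>B :: nat \<Rightarrow> int poly. k \<ge> 1 \<and>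
     C = (\<Prod>i\<in>{0..k}. B i) \<and>
     (\<forall>x::real. poly (map_poly real_of_int (B 0)) x \<noteq> 0) \<and>
     (\<forall>i\<in>{1..k}. irreducible (B i) \<and>
        (\<exists>x::real. poly (map_poly real_of_int (B i)) x = 0) \<and>
        (\<exists>z::complex. poly (map_poly complex_of_int (B i)) z = 0 \<and> z \<notin> \<real>)) \<and>
     (\<forall>i\<in>{0..k}. \<forall>j\<in>{0..k}. i \<noteq> j \<longrightarrow> strongly_coprime (B i) (B j)))"

definition SL_int :: "nat \<Rightarrow> int mat set" where
  "SL_int N = {A. A \<in> carrier_mat N N \<and> det A = 1}"

definition real_eigenvalues :: "int mat \<Rightarrow> real set" where
  "real_eigenvalues M = {\<alpha>. eigenvalue (map_mat real_of_int M) \<alpha>}"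

definition is_basis_Rs :: "nat \<Rightarrow> (nat \<Rightarrow> nat \<Rightarrow> real) \<Rightarrow> bool" where
  "is_basis_Rs s v \<longleftrightarrow>
     (\<forall>c :: nat \<Rightarrow> real. (\<forall>j<s. (\<Sum>i<s. c i * v i j) = 0) \<longrightarrow> (\<forall>i<s. c i = 0)) \<and>
     (\<forall>w :: nat \<Rightarrow> real. \<exists>c :: nat \<Rightarrow> real. \<forall>j<s. (\<Sum>i<s. c i * v i j) = w j)"

definition dirichlet_family :: "nat \<Rightarrow> int mat \<Rightarrow> (nat \<Rightarrow> int poly) \<Rightarrow> bool" where
  "dirichlet_family N M D \<longleftrightarrow>
     (let R = real_eigenvalues M; s = card R in
       (\<forall>i<s. mat_poly_eval (D i) M \<in> SL_int N) \<and>
       (\<forall>i<s. \<forall>\<alpha>\<in>R. poly (map_poly real_of_int (D i)) \<alpha> > 0) \<and>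
       (\<forall>\<alpha>. bij_betw \<alpha> {..<s} R \<longrightarrow>
          is_basis_Rs s (\<lambda>i j. ln (poly (map_poly real_of_int (D i)) (\<alpha> j)))))"

end

theory Submission
  imports Defs "Jordan_Normal_Form.Schur_Decomposition" "HOL-Analysis.Kronecker_Approximation_Theorem"
begin

text \<open>
  Fix a real eigenvalue \<open>\<alpha>\<close> and the irreducible factor \<open>B\<close> of the characteristic polynomial \<open>C = B W\<close>
  having it as a root. Dirichlet's simultaneous approximation of the coefficients of \<open>B / (t - \<alpha>)\<close>
  yields integer polynomials that are arbitrarily small at the roots of \<open>B\<close> other than \<open>\<alpha>\<close> while their
  norms (the product of the values at all roots of \<open>B\<close>) stay bounded. Two members of a sequence of such
  polynomials, decreasing at all roots other than \<open>\<alpha>\<close>, have the same norm \<open>m\<close> and are congruent modulo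
  \<open>m\<close>; their quotient is a unit \<open>u\<close> modulo \<open>B\<close> of norm 1 with \<open>\<bar>u\<bar> < 1\<close> at all roots other than \<open>\<alpha>\<close>.
  With \<open>e \<equiv> 1\<close> modulo \<open>B\<close> and \<open>e \<equiv> 0\<close> modulo \<open>W\<close>, put \<open>D = (1 + e (u - 1))\<^sup>2\<close>.

  Since \<open>B\<close> has a non-real root, where \<open>\<bar>u\<bar> < 1\<close>, the product of the values of \<open>D\<close> at the real
  eigenvalues exceeds 1, whereas \<open>D \<le> 1\<close> at those different from \<open>\<alpha>\<close>. So the logarithms form a strictly
  diagonally dominant matrix, and such a matrix is invertible.
\<close>

section \<open>Polynomials of matrices\<close>

lemma mat_poly_eval_carrier [simp]:
  assumes "A \<in> carrier_mat n n" shows "mat_poly_eval p A \<in> carrier_mat n n"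
proof -
  have "foldr (\<lambda>i B. coeff p i \<cdot>\<^sub>m (A ^\<^sub>m i) + B) ks (0\<^sub>m (dim_row A) (dim_row A)) \<in> carrier_mat n n" for ks
    using assms by (induction ks) (auto simp: pow_carrier_mat)
  thus ?thesis unfolding mat_poly_eval_def by blast
qed

lemma mat_poly_eval_index:
  assumes "A \<in> carrier_mat n n" "i < n" "j < n"
  shows "mat_poly_eval p A $$ (i,j) = (\<Sum>k\<le>degree p. coeff p k * (A ^\<^sub>m k) $$ (i,j))"
proof -
  have *: "foldr (\<lambda>i B. coeff p i \<cdot>\<^sub>m (A ^\<^sub>m i) + B) ks (0\<^sub>m (dim_row A) (dim_row A)) \<in> carrier_mat n n \<and>
     foldr (\<lambda>i B. coeff p i \<cdot>\<^sub>m (A ^\<^sub>m i) + B) ks (0\<^sub>m (dim_row A) (dim_row A)) $$ (i,j)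
      = (\<Sum>k\<leftarrow>ks. coeff p k * (A ^\<^sub>m k) $$ (i,j))" for ks
    using assms by (induction ks) (auto simp: pow_carrier_mat)
  show "mat_poly_eval p A $$ (i,j) = (\<Sum>k\<le>degree p. coeff p k * (A ^\<^sub>m k) $$ (i,j))"
    using *[of "[0..<Suc (degree p)]"]
    by (simp only: mat_poly_eval_def sum_list_distinct_conv_sum_set distinct_upt set_upt
        atLeast0LessThan lessThan_Suc_atMost)
qed

lemma mat_poly_eval_0 [simp]: "A \<in> carrier_mat n n \<Longrightarrow> mat_poly_eval 0 A = 0\<^sub>m n n"
  by (rule eq_matI) (auto simp: mat_poly_eval_index carrier_matD[OF mat_poly_eval_carrier])

text \<open>Horner's rule replaces the \<open>foldr\<close> of the definition by a recursion, so
  that the facts below go by induction over \<open>pCons\<close>.\<close>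

lemma mat_poly_eval_pCons:
  assumes A: "A \<in> carrier_mat n n"
  shows "mat_poly_eval (pCons a p) A = a \<cdot>\<^sub>m 1\<^sub>m n + mat_poly_eval p A * A"
proof (rule eq_matI)
  note c = carrier_matD[OF mat_poly_eval_carrier[OF A]]
  fix i j assume "i < dim_row (a \<cdot>\<^sub>m 1\<^sub>m n + mat_poly_eval p A * A)"
    "j < dim_col (a \<cdot>\<^sub>m 1\<^sub>m n + mat_poly_eval p A * A)"
  with A c have i: "i < n" and j: "j < n" by auto
  \<comment> \<open>The bound \<open>Suc (degree p)\<close> exceeds
    \<open>degree (pCons a p)\<close> by one when \<open>p = 0\<close>; the extra coefficient is
    zero.\<close>
  have 1: "mat_poly_eval (pCons a p) A $$ (i,j) =
      (\<Sum>k\<le>Suc (degree p). coeff (pCons a p) k * (A ^\<^sub>m k) $$ (i,j))"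
    unfolding mat_poly_eval_index[OF A i j]
    by (rule sum.mono_neutral_left) (auto simp: coeff_pCons split: nat.splits intro!: coeff_eq_0)
  have 2: "(A ^\<^sub>m Suc k) $$ (i,j) = (\<Sum>l<n. (A ^\<^sub>m k) $$ (i,l) * A $$ (l,j))" for k
    using A i j by (simp add: times_mat_def scalar_prod_def atLeast0LessThan)
  have "mat_poly_eval (pCons a p) A $$ (i,j) = a * (1\<^sub>m n $$ (i,j)) +
       (\<Sum>k\<le>degree p. coeff p k * (A ^\<^sub>m Suc k) $$ (i,j))"
    unfolding 1 sum.atMost_Suc_shift using A by simp
  also have "(\<Sum>k\<le>degree p. coeff p k * (A ^\<^sub>m Suc k) $$ (i,j)) =
      (\<Sum>l<n. mat_poly_eval p A $$ (i,l) * A $$ (l,j))"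
    unfolding 2 sum_distrib_left
    by (subst sum.swap) (simp add: mat_poly_eval_index[OF A i] sum_distrib_right mult.assoc)
  also have "\<dots> = (mat_poly_eval p A * A) $$ (i,j)"
    using A c i j by (simp add: times_mat_def scalar_prod_def atLeast0LessThan)
  finally show "mat_poly_eval (pCons a p) A $$ (i,j) = (a \<cdot>\<^sub>m 1\<^sub>m n + mat_poly_eval p A * A) $$ (i,j)"
    using A c i j by simp
qed (use A carrier_matD[OF mat_poly_eval_carrier[OF A]] in auto)

text \<open>Used for the passage to the complex numbers, over which the characteristic polynomial of
  an integer matrix splits.\<close>

lemma mat_poly_eval_of_int:
  assumes A: "A \<in> carrier_mat n n"
  shows "map_mat of_int (mat_poly_eval p A) =
    mat_poly_eval (map_poly of_int p) (map_mat (of_int :: int \<Rightarrow> 'a :: {comm_ring_1,ring_char_0}) A)"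
proof (induction p)
  case 0
  show ?case using A by (intro eq_matI) auto
next
  case (pCons a p)
  have A': "map_mat of_int A \<in> carrier_mat n n" using A by simp
  have "map_poly of_int (pCons a p) = pCons (of_int a :: 'a) (map_poly of_int p)"
    by (rule of_int_hom.map_poly_pCons_hom)
  thus ?case
    using A mat_poly_eval_carrier[OF A]
    by (simp add: mat_poly_eval_pCons[OF A] mat_poly_eval_pCons[OF A'] pCons.IH [symmetric]
      of_int_hom.mat_hom_mult[of _ n n, symmetric]) (intro eq_matI,
      auto simp: carrier_matD[OF mat_poly_eval_carrier[OF A]])
qed

text \<open>In a product of two conjugates the inner \<open>Q * P\<close> cancels, so conjugation
  commutes with each Horner step.\<close>

lemma mat_poly_eval_similar:
  assumes "similar_mat_wit A B P Q" and A: "A \<in> carrier_mat n n"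
  shows "similar_mat_wit (mat_poly_eval p A) (mat_poly_eval p B) P Q"
proof -
  note w = similar_mat_witD2[OF A assms(1)]
  have "mat_poly_eval p A = P * mat_poly_eval p B * Q"
  proof (induction p)
    case 0 show ?case using w by simp
  next
    case (pCons a p)
    let ?X = "mat_poly_eval p B"
    have X: "?X \<in> carrier_mat n n" and XB: "?X * B \<in> carrier_mat n n"
      and aI: "a \<cdot>\<^sub>m 1\<^sub>m n \<in> carrier_mat n n" using w mult_carrier_mat[OF mat_poly_eval_carrier w(5)] by auto
    have "mat_poly_eval (pCons a p) A = a \<cdot>\<^sub>m (P * 1\<^sub>m n * Q) + P * ?X * Q * (P * B * Q)"
      unfolding mat_poly_eval_pCons[OF A] pCons.IH using w by simp
    also have "P * ?X * Q * (P * B * Q) = P * ?X * (Q * P) * B * Q"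
      using w X by (smt (verit) assoc_mult_mat mult_carrier_mat)
    also have "\<dots> = P * (?X * B) * Q"
      using w X by (simp add: assoc_mult_mat[of _ n n _ n _ n]
        right_mult_one_mat[of _ n n])
    also have "a \<cdot>\<^sub>m (P * 1\<^sub>m n * Q) = P * (a \<cdot>\<^sub>m 1\<^sub>m n) * Q"
      using w by (simp add: mult_smult_distrib[of _ n n _ n] mult_smult_assoc_mat[of _ n n _ n])
    also have "P * (a \<cdot>\<^sub>m 1\<^sub>m n) * Q + P * (?X * B) * Q = P * (a \<cdot>\<^sub>m 1\<^sub>m n + ?X * B) * Q"
      using mult_add_distrib_mat[OF w(6) aI XB]
        add_mult_distrib_mat[OF mult_carrier_mat[OF w(6) aI] mult_carrier_mat[OF w(6) XB] w(7)] by simp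
    finally show ?case by (simp add: mat_poly_eval_pCons[OF w(5)])
  qed
  thus ?thesis using w unfolding similar_mat_wit_def Let_def by auto
qed

lemma mat_poly_eval_upper_triangular:
  assumes A: "A \<in> carrier_mat n n" and ut: "upper_triangular A"
  shows "upper_triangular (mat_poly_eval p A)"
    and "diag_mat (mat_poly_eval p A) = map (poly p) (diag_mat A)"
proof -
  \<comment> \<open>Both claims share one induction: a diagonal entry of \<open>?X * A\<close>
    reduces to a single term because \<open>?X\<close> is triangular as well.\<close>
  have "\<forall>i<n. (\<forall>j<i. mat_poly_eval p A $$ (i,j) = 0) \<and> mat_poly_eval p A $$ (i,i) = poly p (A $$ (i,i))"
  proof (induction p)
    case 0 show ?case using A by auto
  next
    case (pCons a p)
    let ?X = "mat_poly_eval p A"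
    have X: "?X \<in> carrier_mat n n" using A by simp
    have ut': "A $$ (i,j) = 0" if "j < i" "i < n" for i j using ut A that by auto
    have s: "(?X * A) $$ (i,j) = (\<Sum>l<n. ?X $$ (i,l) * A $$ (l,j))" if "i < n" "j < n" for i j
      using A carrier_matD[OF X] that by (simp add: times_mat_def scalar_prod_def atLeast0LessThan)
    have lo: "(?X * A) $$ (i,j) = 0" if "i < n" "j < i" for i j
    proof -
      \<comment> \<open>A term with \<open>l < i\<close> vanishes by triangularity of
        \<open>?X\<close>, one with \<open>j < i \<le> l\<close> by that of
        \<open>A\<close>.\<close>
      have "?X $$ (i,l) * A $$ (l,j) = 0" if "l < n" for l
        using pCons.IH ut'[of j l] \<open>i < n\<close> \<open>j < i\<close> that by (cases "l < i") auto
      thus ?thesis using s[of i j] that by simp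
    qed
    have di: "(?X * A) $$ (i,i) = ?X $$ (i,i) * A $$ (i,i)" if "i < n" for i
    proof -
      have "?X $$ (i,l) * A $$ (l,i) = 0" if "l < n" "l \<noteq> i" for l
        using pCons.IH ut'[of i l] \<open>i < n\<close> that by (cases "l < i") auto
      hence "(\<Sum>l<n. ?X $$ (i,l) * A $$ (l,i)) = (\<Sum>l\<in>{i}. ?X $$ (i,l) * A $$ (l,i))"
        using that by (intro sum.mono_neutral_right) auto
      thus ?thesis using s[of i i] that by simp
    qed
    show ?case
    proof (intro allI impI conjI)
      fix i assume i: "i < n"
      show "mat_poly_eval (pCons a p) A $$ (i,j) = 0" if "j < i" for j
        using i that A carrier_matD[OF X] lo[OF i that] by (simp add: mat_poly_eval_pCons[OF A])
      show "mat_poly_eval (pCons a p) A $$ (i,i) = poly (pCons a p) (A $$ (i,i))"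
        using i A carrier_matD[OF X] di[OF i] pCons.IH by (simp add: mat_poly_eval_pCons[OF A] mult.commute)
    qed
  qed
  note * = this
  show "upper_triangular (mat_poly_eval p A)"
    using * carrier_matD[OF mat_poly_eval_carrier[OF A]] by (intro upper_triangularI) auto
  show "diag_mat (mat_poly_eval p A) = map (poly p) (diag_mat A)"
    using * A carrier_matD[OF mat_poly_eval_carrier[OF A]] by (auto simp: diag_mat_def)
qed

text \<open>A Schur decomposition conjugates \<open>A\<close> to a triangular matrix with diagonal
  \<open>es\<close>, on whose diagonal a polynomial acts entrywise. So the eigenvalues of
  \<open>mat_poly_eval p A\<close> are the values of \<open>p\<close> on \<open>es\<close>, with
  multiplicities.\<close>

lemma char_poly_mat_poly_eval:
  fixes A :: "complex mat"
  assumes A: "A \<in> carrier_mat n n" and es: "char_poly A = (\<Prod>a\<leftarrow>es. [:- a, 1:])"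
  shows "char_poly (mat_poly_eval p A) = (\<Prod>a\<leftarrow>es. [:- poly p a, 1:])"
    and "Determinant.det (mat_poly_eval p A) = (\<Prod>a\<leftarrow>es. poly p a)"
proof -
  obtain B P Q where "schur_decomposition A es = (B, P, Q)" by (metis prod_cases3)
  from schur_decomposition[OF A es this]
  have wit: "similar_mat_wit A B P Q" and ut: "upper_triangular B" and di: "diag_mat B = es" by auto
  have B: "B \<in> carrier_mat n n" using similar_mat_witD2[OF A wit] by simp
  have sim: "similar_mat (mat_poly_eval p A) (mat_poly_eval p B)"
    using mat_poly_eval_similar[OF wit A] unfolding similar_mat_def by blast
  note ut' = mat_poly_eval_upper_triangular[OF B ut]
  show "char_poly (mat_poly_eval p A) = (\<Prod>a\<leftarrow>es. [:- poly p a, 1:])"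
    unfolding char_poly_similar[OF sim]
      char_poly_upper_triangular[OF mat_poly_eval_carrier[OF B] ut'(1)] ut'(2) di
    by (simp add: o_def)
  show "Determinant.det (mat_poly_eval p A) = (\<Prod>a\<leftarrow>es. poly p a)"
    unfolding det_similar[OF sim]
      det_upper_triangular[OF ut'(1) mat_poly_eval_carrier[OF B]] ut'(2) di by simp
qed

section \<open>Roots of irreducible integer polynomials\<close>

definition zeval :: "int poly \<Rightarrow> complex \<Rightarrow> complex" where
  "zeval p z = poly (of_int_poly p) z"

lemma zeval_add [simp]: "zeval (p + q) z = zeval p z + zeval q z"
  and zeval_diff [simp]: "zeval (p - q) z = zeval p z - zeval q z"
  and zeval_mult [simp]: "zeval (p * q) z = zeval p z * zeval q z"
  and zeval_0 [simp]: "zeval 0 z = 0"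
  and zeval_1 [simp]: "zeval 1 z = 1"
  and zeval_pCons [simp]: "zeval (pCons c p) z = of_int c + z * zeval p z"
  and zeval_smult [simp]: "zeval (Polynomial.smult c p) z = of_int c * zeval p z"
  and zeval_power [simp]: "zeval (p ^ k) z = zeval p z ^ k"
  by (simp_all add: zeval_def hom_distribs)

lemma zeval_prod [simp]: "zeval (prod f I) z = (\<Prod>i\<in>I. zeval (f i) z)"
  by (induction I rule: infinite_finite_induct) auto

lemma zeval_pcompose [simp]: "zeval (pcompose p q) z = zeval p (zeval q z)"
  by (induction p) (auto simp: pcompose_pCons)

lemma zeval_of_real: "zeval p (of_real x) = of_real (poly (of_int_poly p) x)"
  by (induction p) (auto simp: hom_distribs)

lemma zeval_eq_sum: "degree p < n \<Longrightarrow> zeval p z = (\<Sum>i<n. of_int (coeff p i) * z ^ i)"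
  unfolding zeval_def poly_altdef
  by (rule sum.mono_neutral_cong_left) (auto simp: coeff_eq_0)

lemma degree_pos_of_zeval_root:
  assumes "p \<noteq> 0" "zeval p z = 0"
  shows "degree p > 0"
proof (rule ccontr)
  assume "\<not> degree p > 0"
  then obtain c where "p = [:c:]" by (metis degree_eq_zeroE gr0I)
  with assms show False by simp
qed

text \<open>Gauss's lemma enters through primality of irreducible elements in the factorial ring
  \<open>\<int>[t]\<close>, pseudo-division replaces division over the rationals.\<close>

lemma irreducible_dvd_of_common_root:
  assumes B: "irreducible B" "zeval B z = 0" and g: "zeval g z = 0"
  shows "B dvd g"
proof -
  have prime: "prime_elem B" using B(1) by (rule irreducible_imp_prime_elem)
  have B0: "B \<noteq> 0" using B(1) by auto
  \<comment> \<open>A nonzero integer polynomial \<open>m\<close> of least degree vanishing at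
    \<open>z\<close> plays the part of the minimal polynomial of \<open>z\<close>.\<close>
  define P where "P = (\<lambda>d. \<exists>m. m \<noteq> 0 \<and> zeval m z = 0 \<and> degree m = d)"
  have "P (degree B)" using B B0 unfolding P_def by blast
  define d where "d = (LEAST d. P d)"
  have "P d" unfolding d_def using \<open>P (degree B)\<close> by (rule LeastI)
  then obtain m where m: "m \<noteq> 0" "zeval m z = 0" "degree m = d" unfolding P_def by blast
  have d_min: "h = 0" if "zeval h z = 0" "degree h < d" for h
    using that not_less_Least[of "degree h" P] unfolding P_def d_def by blast
  \<comment> \<open>The pseudo-remainder of \<open>h\<close> by \<open>m\<close> vanishes at
    \<open>z\<close> and would have smaller degree than \<open>m\<close>, so it is zero.\<close>
  have m_dvd: "\<exists>c. c \<noteq> 0 \<and> m dvd Polynomial.smult c h" if h: "zeval h z = 0" for h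
  proof -
    obtain c q where c: "c \<noteq> 0" "Polynomial.smult c h = m * q + pseudo_mod h m"
      using pseudo_mod(1)[OF m(1), of h] by blast
    have "zeval (pseudo_mod h m) z = zeval (Polynomial.smult c h) z - zeval m z * zeval q z"
      by (simp add: c(2))
    also have "\<dots> = 0" using h m by simp
    finally have "pseudo_mod h m = 0"
      using pseudo_mod(2)[OF m(1), of h] m(3) d_min by auto
    thus ?thesis using c by auto
  qed
  have not_const: "\<not> B dvd [:c:]" if "c \<noteq> 0" for c
  proof
    assume "B dvd [:c:]"
    then obtain k where "[:c:] = B * k" by (elim dvdE)
    hence "zeval [:c:] z = 0" using B by (metis zeval_mult mult_zero_left)
    thus False using that by simp
  qed
  obtain c q where c: "c \<noteq> 0" and q: "Polynomial.smult c B = m * q" using m_dvd[OF B(2)] by (auto elim!: dvdE)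
  \<comment> \<open>Primality of \<open>B\<close> is used twice. First, \<open>B\<close> divides
    \<open>m * q\<close> but not \<open>q\<close>, since otherwise a nonzero constant would be a
    multiple of \<open>m\<close>; so \<open>B\<close> divides \<open>m\<close>. Then
    \<open>B\<close> divides a nonzero constant times \<open>g\<close>, but not the
    constant.\<close>
  have "B dvd m * q" by (metis q dvd_smult dvd_refl)
  moreover have "\<not> B dvd q"
  proof
    assume "B dvd q"
    then obtain q' where "q = B * q'" by (elim dvdE)
    hence "B * [:c:] = B * (m * q')" using q by (simp add: mult.left_commute)
    hence "[:c:] = m * q'" using B0 by (metis mult_left_cancel)
    hence "zeval [:c:] z = 0" using m by (metis zeval_mult mult_zero_left)
    thus False using c by simp
  qed
  ultimately have "B dvd m" using prime by (simp add: prime_elem_dvd_mult_iff)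
  moreover obtain c' where c': "c' \<noteq> 0" "m dvd Polynomial.smult c' g" using m_dvd[OF g] by blast
  ultimately have "B dvd [:c':] * g" using dvd_trans by simp
  thus ?thesis using not_const[OF c'(1)] prime by (simp only: prime_elem_dvd_mult_iff) auto
qed

lemma degree_le_of_zeval_common_root:
  assumes "irreducible B" "zeval B z = 0" "g \<noteq> 0" "zeval g z = 0"
  shows "degree B \<le> degree g"
  using irreducible_dvd_of_common_root[OF assms(1,2,4)] assms(3) by (rule dvd_imp_degree_le)

text \<open>A multiple root would be shared with \<open>pderiv B\<close>, which is nonzero and of
  smaller degree than \<open>B\<close>.\<close>

lemma irreducible_imp_rsquarefree_of_int_poly:
  assumes B: "irreducible (B :: int poly)"
  shows "rsquarefree (of_int_poly B :: complex poly)"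
proof (subst rsquarefree_roots, safe)
  fix a assume a: "poly (of_int_poly B) a = 0" "poly (pderiv (of_int_poly B)) (a::complex) = 0"
  have B0: "B \<noteq> 0" using B by auto
  have r: "zeval B a = 0" "zeval (pderiv B) a = 0"
    using a by (simp_all add: zeval_def of_int_hom.map_poly_pderiv)
  have pos: "degree B > 0" using degree_pos_of_zeval_root[OF B0 r(1)] .
  hence "pderiv B \<noteq> 0" by (simp add: pderiv_eq_0_iff)
  from degree_le_of_zeval_common_root[OF B r(1) this r(2)] pos show False
    by (simp add: degree_pderiv)
qed

text \<open>Multiply the two Bezout relations and collect the terms containing
  \<open>P\<close>.\<close>

lemma strongly_coprime_mult:
  assumes "strongly_coprime P Q" "strongly_coprime P R"
  shows "strongly_coprime P (Q * R)"
proof -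
  obtain u v u' v' where "u * P + v * Q = 1" "u' * P + v' * R = 1"
    using assms unfolding strongly_coprime_def by blast
  hence "(u * P + v * Q) * (u' * P + v' * R) = 1" by simp
  hence "(u * u' * P + u * v' * R + v * Q * u') * P + (v * v') * (Q * R) = 1"
    by (simp add: algebra_simps)
  thus ?thesis unfolding strongly_coprime_def by blast
qed

lemma strongly_coprime_prod:
  assumes "finite I" "\<And>i. i \<in> I \<Longrightarrow> strongly_coprime P (B i)"
  shows "strongly_coprime P (\<Prod>i\<in>I. B i)"
  using assms
proof (induction I rule: finite_induct)
  case empty
  have "0 * P + 1 * 1 = 1" by simp
  thus ?case unfolding strongly_coprime_def by (simp only: prod.empty) blast
qed (simp add: strongly_coprime_mult)

section \<open>Norms\<close>

text \<open>Roots are collected without multiplicity. Those of an irreducible \<open>B\<close> are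
  simple, so a product of values over \<open>zroots B\<close> still runs over all
  \<open>degree B\<close> roots; this product serves as the norm.\<close>

definition zroots :: "int poly \<Rightarrow> complex set" where
  "zroots B = {z. zeval B z = 0}"

lemma finite_zroots: "B \<noteq> 0 \<Longrightarrow> finite (zroots B)"
  unfolding zroots_def zeval_def by (rule poly_roots_finite) simp

lemma card_zroots:
  assumes "irreducible B"
  shows "card (zroots B) = degree B"
proof -
  let ?p = "of_int_poly B :: complex poly"
  have "degree B = degree (Polynomial.smult (lead_coeff ?p) (\<Prod>z|poly ?p z = 0. [:-z, 1:]))"
    by (subst complex_poly_decompose_rsquarefree[OF irreducible_imp_rsquarefree_of_int_poly[OF assms]]) simp
  also have "\<dots> = degree (\<Prod>z\<in>zroots B. [:-z, 1:])"
    using assms by (auto simp: zroots_def zeval_def)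
  also have "\<dots> = card (zroots B)"
    by (subst degree_prod_eq_sum_degree) auto
  finally show ?thesis by simp
qed

lemma order_prod_list_linear: "Polynomial.order a (\<Prod>x\<leftarrow>xs. [:- x, 1:]) = count_list xs (a :: 'a :: field)"
proof (induction xs)
  case Nil
  show ?case by (simp add: order_1_eq_0)
next
  case (Cons x xs)
  have "(\<Prod>x\<leftarrow>x # xs. [:- x, 1:]) \<noteq> 0" by (subst prod_list_zero_iff) auto
  hence "Polynomial.order a (\<Prod>x\<leftarrow>x # xs. [:- x, 1:]) = Polynomial.order a [:- x, 1:] + Polynomial.order a (\<Prod>x\<leftarrow>xs. [:- x, 1:])"
    using Polynomial.order_mult[of "[:- x, 1:]" "\<Prod>x\<leftarrow>xs. [:- x, 1:]" a]
    unfolding list.map prod_list.Cons by blast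
  moreover have "Polynomial.order a [:- x, 1:] = (if x = a then 1 else 0)"
    using order_power_n_n[of a 1] by (auto intro: order_0I)
  ultimately show ?case using Cons by simp
qed

text \<open>The eigenvalues of \<open>mat_poly_eval P M\<close> are the values of \<open>P\<close>
  at the roots of \<open>B * W\<close>. The roots of \<open>W\<close> contribute 1, and each root of
  \<open>B\<close> occurs exactly once. So the norm is the determinant of an integer matrix and, up
  to sign, the constant term of an integer polynomial having the values of \<open>P\<close> as
  roots.\<close>

lemma det_mat_poly_eval_eq_prod:
  assumes M: "M \<in> carrier_mat N N" and cp: "char_poly M = B * W"
    and irr: "irreducible B" and disj: "zroots B \<inter> zroots W = {}"
    and P: "\<forall>z\<in>zroots W. zeval P z = 1"
  shows "of_int (Determinant.det (mat_poly_eval P M)) = (\<Prod>z\<in>zroots B. zeval P z)"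
    and "\<And>z. z \<in> zroots B \<Longrightarrow> zeval (char_poly (mat_poly_eval P M)) (zeval P z) = 0"
    and "of_int (coeff (char_poly (mat_poly_eval P M)) 0) = (-1) ^ N * (\<Prod>z\<in>zroots B. zeval P z)"
proof -
  define A :: "complex mat" where "A = map_mat of_int M"
  have A: "A \<in> carrier_mat N N" using M by (simp add: A_def)
  obtain es where es: "char_poly A = (\<Prod>a\<leftarrow>es. [:- a, 1:])" and len: "length es = N"
    using char_poly_factorized[OF A] by blast
  have cpA: "char_poly A = of_int_poly B * of_int_poly W"
    unfolding A_def of_int_hom.char_poly_hom[OF M] cp by (simp add: hom_distribs)
  have B0: "of_int_poly B \<noteq> (0 :: complex poly)" using irr by auto
  have W0: "of_int_poly W \<noteq> (0 :: complex poly)"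
    using degree_monic_char_poly[OF M] cp by auto
  hence W0': "W \<noteq> 0" by auto
  have set_es: "set es = zroots B \<union> zroots W"
  proof -
    have "set es = {z. poly (char_poly A) z = 0}" unfolding es by (induction es) auto
    thus ?thesis unfolding cpA by (auto simp: zroots_def zeval_def)
  qed
  have count: "count_list es z = 1" if z: "z \<in> zroots B" for z
  proof -
    have "count_list es z = Polynomial.order z (of_int_poly B * of_int_poly W)"
      using order_prod_list_linear[of z es] cpA es by simp
    also have "\<dots> = Polynomial.order z (of_int_poly B) + Polynomial.order z (of_int_poly W)"
      using B0 W0 by (simp add: order_mult)
    also have "Polynomial.order z (of_int_poly W) = 0"
      using disj z by (intro order_0I) (auto simp: zroots_def zeval_def)
    also have "Polynomial.order z (of_int_poly B) = 1"
      using rsquarefree_root_order[OF irreducible_imp_rsquarefree_of_int_poly[OF irr] _ B0] z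
      by (simp add: zroots_def zeval_def)
    finally show ?thesis by simp
  qed
  have fin: "finite (zroots B)" using irr by (intro finite_zroots) auto
  have prod: "(\<Prod>a\<leftarrow>es. zeval P a) = (\<Prod>z\<in>zroots B. zeval P z)"
  proof -
    have "(\<Prod>a\<leftarrow>es. zeval P a) = prod_mset (image_mset (zeval P) (mset es))"
      by (metis mset_map prod_mset_prod_list)
    also have "\<dots> = (\<Prod>z\<in>set es. zeval P z ^ count_list es z)"
      by (simp add: image_prod_mset_multiplicity count_mset)
    \<comment> \<open>Members of \<open>es\<close> outside \<open>zroots B\<close> are roots of
      \<open>W\<close> and contribute powers of 1, whatever their multiplicity.\<close>
    also have "\<dots> = (\<Prod>z\<in>zroots B. zeval P z)"
      using P count by (intro prod.mono_neutral_cong_right) (auto simp: set_es fin finite_zroots W0')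
    finally show ?thesis .
  qed
  have ev: "mat_poly_eval (of_int_poly P) A = map_mat of_int (mat_poly_eval P M)"
    unfolding A_def by (rule mat_poly_eval_of_int[OF M, symmetric])
  note cpP = char_poly_mat_poly_eval[OF A es, of "of_int_poly P", folded zeval_def]
  show "of_int (Determinant.det (mat_poly_eval P M)) = (\<Prod>z\<in>zroots B. zeval P z)"
    using cpP(2) unfolding prod ev by simp
  have f: "of_int_poly (char_poly (mat_poly_eval P M)) = (\<Prod>a\<leftarrow>es. [:- zeval P a, 1:])"
    using cpP(1) unfolding ev of_int_hom.char_poly_hom[OF mat_poly_eval_carrier[OF M]] .
  show "zeval (char_poly (mat_poly_eval P M)) (zeval P z) = 0" if "z \<in> zroots B" for z
    unfolding zeval_def[of "char_poly _"] f poly_prod_list prod_list_zero_iff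
    using that set_es by (auto simp: image_iff intro!: bexI[of _ z])
  have "of_int (coeff (char_poly (mat_poly_eval P M)) 0) = poly (\<Prod>a\<leftarrow>es. [:- zeval P a, 1:]) 0"
    unfolding f[symmetric] by (simp add: poly_0_coeff_0)
  also have "\<dots> = (-1) ^ length es * (\<Prod>a\<leftarrow>es. zeval P a)"
    by (induction es) auto
  finally show "of_int (coeff (char_poly (mat_poly_eval P M)) 0) = (-1) ^ N * (\<Prod>z\<in>zroots B. zeval P z)"
    using len prod by simp
qed

text \<open>The summand \<open>v * W\<close> of a Bezout relation is the Chinese remainder
  idempotent; at a common root the relation would read 0 = 1.\<close>

lemma strongly_coprime_idempotent:
  assumes "strongly_coprime B W"
  obtains e where "\<And>z. z \<in> zroots B \<Longrightarrow> zeval e z = 1" "\<And>z. z \<in> zroots W \<Longrightarrow> zeval e z = 0"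
    "zroots B \<inter> zroots W = {}"
proof -
  obtain u v where "u * B + v * W = 1" using assms unfolding strongly_coprime_def by blast
  hence *: "zeval u z * zeval B z + zeval v z * zeval W z = 1" for z
    by (metis zeval_1 zeval_add zeval_mult)
  show thesis
  proof (rule that[of "v * W"])
    show "zeval (v * W) z = 1" if "z \<in> zroots B" for z
      using that *[of z] by (simp add: zroots_def)
    show "zeval (v * W) z = 0" if "z \<in> zroots W" for z
      using that by (simp add: zroots_def)
    show "zroots B \<inter> zroots W = {}"
    proof (rule ccontr)
      assume "zroots B \<inter> zroots W \<noteq> {}"
      then obtain z where "zeval B z = 0" "zeval W z = 0" by (auto simp: zroots_def)
      with *[of z] show False by simp
    qed
  qed
qed

text \<open>Replacing \<open>p\<close> by \<open>P\<close>, equal to \<open>p\<close> at the roots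
  of \<open>B\<close> and to 1 at those of \<open>W\<close>, makes the norm an integer determinant.
  The value of \<open>p\<close> at \<open>z\<close> is then a root of the integer polynomial
  \<open>pCons c f\<close>, whose constant term is the norm up to sign. Irreducibility turns this
  into a congruence modulo \<open>B\<close>: \<open>p\<close> divides its norm, with cofactor
  \<open>g\<close>.\<close>

lemma integral_norm:
  assumes M: "M \<in> carrier_mat N N" and cp: "char_poly M = B * W"
    and irr: "irreducible B" and sc: "strongly_coprime B W" and z: "z \<in> zroots B"
  shows "\<exists>m g. of_int m = (\<Prod>z\<in>zroots B. zeval p z) \<and> B dvd p * g - [:m:]"
proof -
  obtain e where e1: "\<And>z. z \<in> zroots B \<Longrightarrow> zeval e z = 1"
    and e0: "\<And>z. z \<in> zroots W \<Longrightarrow> zeval e z = 0" and disj: "zroots B \<inter> zroots W = {}"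
    using strongly_coprime_idempotent[OF sc] by blast
  define P where "P = 1 + e * (p - 1)"
  have P1: "\<forall>z\<in>zroots W. zeval P z = 1" using e0 by (simp add: P_def)
  have Pp: "zeval P z = zeval p z" if "z \<in> zroots B" for z using e1[OF that] by (simp add: P_def)
  note D = det_mat_poly_eval_eq_prod[OF M cp irr disj P1]
  define m where "m = Determinant.det (mat_poly_eval P M)"
  have m: "of_int m = (\<Prod>z\<in>zroots B. zeval p z)"
    unfolding m_def D(1) by (intro prod.cong refl Pp)
  obtain c f where cf: "char_poly (mat_poly_eval P M) = pCons c f" using pCons_cases by blast
  have "(of_int c :: complex) = of_int ((-1) ^ N * m)"
    using D(1) D(3) cf by (simp add: m_def)
  hence c: "c = (-1) ^ N * m" by (simp only: of_int_eq_iff)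
  define h where "h = pcompose f p"
  have "zeval (pcompose (pCons c f) p) z = 0" using D(2)[OF z] Pp[OF z] cf by simp
  hence "B dvd pcompose (pCons c f) p"
    using irreducible_dvd_of_common_root[OF irr] z by (auto simp: zroots_def)
  hence "B dvd [:c:] + p * h" by (simp add: pcompose_pCons h_def)
  \<comment> \<open>Since \<open>c = (-1) ^ N * m\<close>, this factor turns the constant
    \<open>c\<close> into \<open>- m\<close>.\<close>
  hence "B dvd [:- ((-1) ^ N):] * ([:c:] + p * h)" by (rule dvd_mult)
  also have "[:- ((-1) ^ N):] * ([:c:] + p * h) = p * ([:- ((-1) ^ N):] * h) - [:m:]"
    by (simp add: c algebra_simps flip: power_mult_distrib mult.assoc)
  finally show ?thesis using m by blast
qed

section \<open>Units\<close>

text \<open>The cofactor \<open>q\<close> of \<open>t - \<alpha>\<close> in \<open>B\<close>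
  vanishes at the \<open>n\<close> other roots. Some multiple \<open>m * q\<close> with
  \<open>0 < m \<le> h ^ n\<close> has coefficients within \<open>1 / h\<close> of integers;
  rounding them gives \<open>p\<close> of order \<open>1 / h\<close> at these \<open>n\<close> roots
  and at most of order \<open>h ^ n\<close> at \<alpha>. The powers of \<open>h\<close> cancel in
  the norm.\<close>

lemma small_at_other_roots:
  fixes \<alpha> :: real
  assumes irr: "irreducible B" and \<alpha>: "poly (of_int_poly B) \<alpha> = 0"
  obtains K where "\<And>\<epsilon>. \<epsilon> > 0 \<Longrightarrow> \<exists>p. p \<noteq> 0 \<and> degree p < degree B \<and>
      (\<forall>z\<in>zroots B - {of_real \<alpha>}. norm (zeval p z) < \<epsilon>) \<and> (\<Prod>z\<in>zroots B. norm (zeval p z)) \<le> K"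
proof -
  have B0: "B \<noteq> 0" using irr by auto
  define S' where "S' = zroots B - {of_real \<alpha>}"
  have fin: "finite (zroots B)" "finite S'" using finite_zroots[OF B0] by (auto simp: S'_def)
  have \<alpha>_root: "of_real \<alpha> \<in> zroots B" using \<alpha> by (simp add: zroots_def zeval_of_real)
  have pos: "degree B > 0"
    using degree_pos_of_zeval_root[OF B0] \<alpha>_root by (auto simp: zroots_def)
  then obtain n where n: "degree B = Suc n" using gr0_implies_Suc by blast
  have card: "card S' = n"
    using card_zroots[OF irr] fin(1) \<alpha>_root by (simp add: S'_def n)
  obtain q where q: "of_int_poly B = [:- \<alpha>, 1:] * q" using \<alpha> poly_eq_0_iff_dvd by (metis dvdE)
  have q0: "q \<noteq> 0" using q B0 by (metis mult_zero_right of_int_poly_hom.hom_0_iff)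
  have deg_q: "degree q = n"
  proof -
    have "degree (of_int_poly B :: real poly) = Suc n" using n by simp
    hence "Suc n = degree ([:- \<alpha>, 1:] * q)" by (simp only: q)
    thus ?thesis using q0 by (subst (asm) degree_mult_eq) auto
  qed
  \<comment> \<open>The top coefficient of \<open>m * q\<close> is thus an integer already, and only
    \<open>n\<close> coefficients are approximated. This gives the exponent \<open>n\<close> in
    \<open>m \<le> h ^ n\<close>, matching the number of other roots.\<close>
  have lc_q: "coeff q n = of_int (lead_coeff B)"
  proof -
    have "lead_coeff (of_int_poly B) = lead_coeff [:- \<alpha>, 1:] * lead_coeff q"
      unfolding q by (rule lead_coeff_mult)
    thus ?thesis using deg_q by simp
  qed
  define Q where "Q = (\<lambda>z::complex. \<Sum>i<Suc n. of_real (coeff q i) * z ^ i)"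
  have B_eq: "zeval B z = (z - of_real \<alpha>) * Q z" for z
  proof -
    have "of_int_poly B = (map_poly of_real (of_int_poly B :: real poly) :: complex poly)"
      by (simp add: map_poly_map_poly o_def)
    also have "\<dots> = [:- of_real \<alpha>, 1:] * map_poly of_real q"
    proof -
      interpret of_real_poly: map_poly_comm_ring_hom "of_real :: real \<Rightarrow> complex" ..
      show ?thesis unfolding q of_real_poly.hom_mult by (simp add: hom_distribs)
    qed
    finally have "zeval B z = (z - of_real \<alpha>) * poly (map_poly of_real q) z"
      by (simp only: zeval_def poly_mult) simp
    also have "poly (map_poly of_real q) z = Q z"
      by (simp add: Q_def poly_altdef deg_q lessThan_Suc_atMost)
    finally show ?thesis .
  qed
  have Q0: "Q z = 0" if "z \<in> S'" for z using that B_eq[of z] by (auto simp: S'_def zroots_def)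
  \<comment> \<open>A bound, uniform over the roots, that turns coefficient errors of at most
    \<open>1 / h\<close> into value errors of at most \<open>c / h\<close>.\<close>
  define c where "c = (\<Sum>z\<in>zroots B. \<Sum>i<Suc n. norm z ^ i)"
  have c_ge: "(\<Sum>i<Suc n. norm z ^ i) \<le> c" if "z \<in> zroots B" for z
    unfolding c_def using that fin by (intro member_le_sum) (auto intro!: sum_nonneg add_nonneg_nonneg)
  have c0: "c \<ge> 0" unfolding c_def by (intro sum_nonneg) auto
  \<comment> \<open>This is \<open>h ^ n * (norm (Q \<alpha>) + c)\<close>, the bound at \<alpha>,
    times \<open>(c / h) ^ n\<close> from the other roots; it depends on neither \<open>h\<close>
    nor \<epsilon>.\<close>
  define K where "K = (norm (Q (of_real \<alpha>)) + c) * c ^ n"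
  show thesis
  proof (rule that[of K])
    fix \<epsilon> :: real assume \<epsilon>: "\<epsilon> > 0"
    obtain h :: nat where h: "h > c / \<epsilon>" using reals_Archimedean2 by blast
    have h0: "h > 0" using h c0 \<epsilon> by (metis divide_nonneg_pos gr0I not_less of_nat_0)
    have ch: "c / h < \<epsilon>" using h h0 \<epsilon> by (simp add: field_simps)
    obtain m a where m: "0 < m" "m \<le> int (h ^ n)"
      and a: "\<And>i. i < n \<Longrightarrow> \<bar>of_int m * coeff q i - of_int (a i)\<bar> < 1 / h"
      using Dirichlet_approx_simult[OF h0, of n "coeff q"] by blast
    define p where "p = (\<Sum>i<n. monom (a i) i) + monom (m * lead_coeff B) n"
    have coeff_p: "coeff p i = (if i < n then a i else if i = n then m * lead_coeff B else 0)" for i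
    proof -
      have "coeff p i = (\<Sum>k<n. if k = i then a k else 0) + (if n = i then m * lead_coeff B else 0)"
        by (simp add: p_def coeff_sum)
      thus ?thesis by simp
    qed
    have deg_p: "degree p < Suc n"
      by (rule le_imp_less_Suc, rule degree_le) (simp add: coeff_p)
    have p0: "p \<noteq> 0"
    proof
      assume "p = 0"
      hence "coeff p n = 0" by simp
      thus False using m(1) B0 by (simp add: coeff_p)
    qed
    have diff: "norm (zeval p z - of_int m * Q z) \<le> c / h" if z: "z \<in> zroots B" for z
    proof -
      have "zeval p z - of_int m * Q z =
          (\<Sum>i<Suc n. of_real (of_int (coeff p i) - of_int m * coeff q i) * z ^ i)"
        unfolding zeval_eq_sum[OF deg_p] Q_def sum_distrib_left sum_subtractf[symmetric]
        by (intro sum.cong) (auto simp: algebra_simps)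
      also have "norm \<dots> \<le> (\<Sum>i<Suc n. 1 / h * norm z ^ i)"
      proof (intro sum_norm_le)
        fix i assume i: "i \<in> {..<Suc n}"
        have "\<bar>of_int (coeff p i) - of_int m * coeff q i\<bar> \<le> 1 / h"
          using a[of i] i lc_q by (cases "i < n") (auto simp: coeff_p abs_minus_commute less_Suc_eq)
        thus "norm (of_real (of_int (coeff p i) - of_int m * coeff q i) * z ^ i) \<le> 1 / h * norm z ^ i"
          by (simp only: norm_mult norm_power norm_of_real) (intro mult_right_mono, auto)
      qed
      also have "\<dots> = (\<Sum>i<Suc n. norm z ^ i) / h" by (simp add: sum_divide_distrib add_divide_distrib)
      also have "\<dots> \<le> c / h" using c_ge[OF z] by (intro divide_right_mono) auto
      finally show ?thesis .
    qed
    have small: "norm (zeval p z) \<le> c / h" if "z \<in> S'" for z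
      using diff[of z] Q0[OF that] that by (simp add: S'_def)
    have m_le: "of_int m \<le> real h ^ n" using m(2) by (metis of_int_le_iff of_int_of_nat_eq of_nat_power)
    \<comment> \<open>This crude estimate absorbs the rounding error at \<alpha> into the factor
      \<open>h ^ n\<close>.\<close>
    have hn: "c / h \<le> real h ^ n * c"
    proof -
      have "1 \<le> real h" using h0 by simp
      moreover have "1 \<le> real h ^ n" using h0 by simp
      ultimately have "1 * 1 \<le> real h ^ n * real h" by (intro mult_mono) auto
      hence "c * 1 \<le> c * (real h ^ n * real h)" using c0 by (intro mult_left_mono) auto
      thus ?thesis using h0 by (simp add: field_simps)
    qed
    have "norm (zeval p (of_real \<alpha>)) \<le> norm (of_int m * Q (of_real \<alpha>)) + c / h"
      using diff[OF \<alpha>_root] norm_triangle_sub[of "zeval p (of_real \<alpha>)" "of_int m * Q (of_real \<alpha>)"] by linarith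
    also have "norm (of_int m * Q (of_real \<alpha>)) = of_int m * norm (Q (of_real \<alpha>))"
      using m(1) by (simp add: norm_mult)
    also have "\<dots> \<le> real h ^ n * norm (Q (of_real \<alpha>))" using m_le by (intro mult_right_mono) auto
    finally have big: "norm (zeval p (of_real \<alpha>)) \<le> real h ^ n * (norm (Q (of_real \<alpha>)) + c)"
      using hn by (simp add: distrib_left)
    have "(\<Prod>z\<in>zroots B. norm (zeval p z)) = norm (zeval p (of_real \<alpha>)) * (\<Prod>z\<in>S'. norm (zeval p z))"
      unfolding S'_def using fin(1) \<alpha>_root by (rule prod.remove)
    also have "\<dots> \<le> (real h ^ n * (norm (Q (of_real \<alpha>)) + c)) * (\<Prod>z\<in>S'. c / h)"
      using big small c0 by (intro mult_mono prod_mono) (auto intro!: prod_nonneg mult_nonneg_nonneg)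
    also have "\<dots> = K" using h0 by (simp add: card K_def power_divide)
    finally have "(\<Prod>z\<in>zroots B. norm (zeval p z)) \<le> K" .
    moreover have "\<forall>z\<in>zroots B - {of_real \<alpha>}. norm (zeval p z) < \<epsilon>"
      using small ch unfolding S'_def by (meson le_less_trans)
    ultimately show "\<exists>p. p \<noteq> 0 \<and> degree p < degree B \<and>
      (\<forall>z\<in>zroots B - {of_real \<alpha>}. norm (zeval p z) < \<epsilon>) \<and> (\<Prod>z\<in>zroots B. norm (zeval p z)) \<le> K"
      using p0 deg_p n by auto
  qed
qed

text \<open>A pigeonhole argument gives two members of the sequence with equal norm \<open>m\<close>
  that are congruent modulo \<open>m\<close>. As each divides \<open>m\<close> modulo
  \<open>B\<close>, their quotient is represented by an integer polynomial. Its norm is 1, and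
  strict decrease along the sequence makes it small at the other roots.\<close>

lemma exists_unit_small_at_other_roots:
  fixes \<alpha> :: real
  assumes irr: "irreducible B" and \<alpha>: "poly (of_int_poly B) \<alpha> = 0"
    and norm: "\<And>p. \<exists>m g. of_int m = (\<Prod>z\<in>zroots B. zeval p z) \<and> B dvd p * g - [:m:]"
  obtains u where "(\<Prod>z\<in>zroots B. zeval u z) = 1"
    "\<And>z. z \<in> zroots B \<Longrightarrow> z \<noteq> of_real \<alpha> \<Longrightarrow> norm (zeval u z) < 1"
proof -
  have B0: "B \<noteq> 0" using irr by auto
  note fin = finite_zroots[OF B0]
  define S' where "S' = zroots B - {of_real \<alpha>}"
  have finS': "finite S'" using fin by (simp add: S'_def)
  obtain K where K: "\<And>\<epsilon>. \<epsilon> > 0 \<Longrightarrow> \<exists>p. p \<noteq> 0 \<and> degree p < degree B \<and>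
      (\<forall>z\<in>S'. norm (zeval p z) < \<epsilon>) \<and> (\<Prod>z\<in>zroots B. norm (zeval p z)) \<le> K"
    using small_at_other_roots[OF irr \<alpha>] unfolding S'_def by metis
  \<comment> \<open>The invariant of the sequence. Being nonzero of degree below
    \<open>degree B\<close> excludes zeros at the roots of \<open>B\<close>; the bound
    \<open>K\<close> leaves finitely many norms.\<close>
  define G where "G = (\<lambda>p. p \<noteq> 0 \<and> degree p < degree B \<and> (\<Prod>z\<in>zroots B. norm (zeval p z)) \<le> K)"
  have nz: "zeval p z \<noteq> 0" if "G p" "z \<in> zroots B" for p z
    using degree_le_of_zeval_common_root[OF irr _ _, of z p] that by (auto simp: G_def zroots_def)
  have "\<exists>p'. G p' \<and> (\<forall>z\<in>S'. norm (zeval p' z) < norm (zeval p z))" if "G p" for p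
  proof -
    \<comment> \<open>Inserting 1 keeps \<open>Min\<close> meaningful when \<alpha> is the only
      root.\<close>
    define \<epsilon> where "\<epsilon> = Min (insert 1 ((\<lambda>z. norm (zeval p z)) ` S'))"
    have "\<epsilon> > 0" using finS' nz[OF that] by (auto simp: \<epsilon>_def S'_def)
    then obtain p' where p': "G p'" "\<forall>z\<in>S'. norm (zeval p' z) < \<epsilon>" using K unfolding G_def by metis
    moreover have "\<epsilon> \<le> norm (zeval p z)" if "z \<in> S'" for z
      unfolding \<epsilon>_def using finS' that by (intro Min_le) auto
    ultimately show ?thesis by force
  qed
  moreover obtain p0 where "G p0" using K[of 1] unfolding G_def by auto
  ultimately obtain f where f: "\<And>k. G (f k)"
    and f_Suc: "\<And>k. \<forall>z\<in>S'. norm (zeval (f (Suc k)) z) < norm (zeval (f k) z)"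
    using dependent_nat_choice[of "\<lambda>_. G" "\<lambda>_ p p'. \<forall>z\<in>S'. norm (zeval p' z) < norm (zeval p z)"]
    by blast
  have decr: "norm (zeval (f l) z) < norm (zeval (f k) z)" if "k < l" "z \<in> S'" for k l z
    using that(1)
  proof (induction l)
    case (Suc l)
    thus ?case using f_Suc[of l] that(2) by (cases "k = l") force+
  qed simp
  obtain nm gg where nm: "\<And>p. of_int (nm p) = (\<Prod>z\<in>zroots B. zeval p z)"
    and gg: "\<And>p. B dvd p * gg p - [:nm p:]" using norm by metis
  have nm0: "nm (f k) \<noteq> 0" for k
  proof
    assume "nm (f k) = 0"
    hence "(\<Prod>z\<in>zroots B. zeval (f k) z) = 0" using nm[of "f k"] by simp
    thus False using fin nz[OF f] by simp
  qed
  define L where "L = \<lceil>K\<rceil>"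
  have nm_le: "\<bar>nm (f k)\<bar> \<le> L" for k
  proof -
    have "real_of_int \<bar>nm (f k)\<bar> = norm (complex_of_int (nm (f k)))" by simp
    also have "\<dots> \<le> K" unfolding nm prod_norm[symmetric] using f[of k] by (simp add: G_def)
    finally show ?thesis unfolding L_def by linarith
  qed
  \<comment> \<open>The pigeonholes: the norm and the coefficients modulo it. A remainder takes the
    sign of its modulus, which may be negative, hence the symmetric range \<open>{-L..L}\<close>
    below.\<close>
  define key where "key = (\<lambda>k. (nm (f k), map (\<lambda>i. coeff (f k) i mod nm (f k)) [0..<degree B]))"
  have "range key \<subseteq> {-L..L} \<times> {xs. set xs \<subseteq> {-L..L} \<and> length xs = degree B}"
  proof safe
    fix k x y assume "(x, y) = key k"
    hence x: "x = nm (f k)" and y: "y = map (\<lambda>i. coeff (f k) i mod nm (f k)) [0..<degree B]"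
      by (auto simp: key_def)
    show "x \<in> {-L..L}" using nm_le[of k] x by auto
    show "length y = degree B" using y by simp
    fix t assume "t \<in> set y"
    then obtain i where "t = coeff (f k) i mod nm (f k)" using y by auto
    thus "t \<in> {-L..L}" using abs_mod_less[OF nm0[of k], of "coeff (f k) i"] nm_le[of k] by auto
  qed
  moreover have "finite ({-L..L} \<times> {xs. set xs \<subseteq> {-L..L} \<and> length xs = degree B})"
    by (intro finite_cartesian_product finite_lists_length_eq) auto
  ultimately have "finite (range key)" by (rule finite_subset)
  hence "\<not> inj key" using range_inj_infinite by blast
  then obtain k l where kl: "k < l" "key k = key l"
    unfolding inj_def by (metis linorder_neqE_nat)
  define m where "m = nm (f k)"
  have nml: "nm (f l) = m" using kl by (simp add: key_def m_def)
  have m0: "m \<noteq> 0" using nm0 by (simp add: m_def)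
  have "[:m:] dvd f l - f k"
  proof (subst const_poly_dvd_iff, intro allI)
    fix i
    show "m dvd coeff (f l - f k) i"
    proof (cases "i < degree B")
      case True
      have "map (\<lambda>i. coeff (f k) i mod m) [0..<degree B] = map (\<lambda>i. coeff (f l) i mod m) [0..<degree B]"
        using kl(2) nml by (simp add: key_def m_def)
      hence "coeff (f k) i mod m = coeff (f l) i mod m" using True by (simp add: map_eq_conv)
      thus ?thesis by (simp add: mod_eq_dvd_iff dvd_diff_commute)
    next
      case False
      thus ?thesis using f[of k] f[of l] by (simp add: G_def coeff_eq_0)
    qed
  qed
  then obtain r where "f l - f k = [:m:] * r" by (elim dvdE)
  hence r: "f l = f k + [:m:] * r" by (simp add: algebra_simps)
  \<comment> \<open>Modulo \<open>B\<close>, \<open>f k * gg (f k)\<close> is \<open>m\<close>, so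
    \<open>f k * u\<close> is \<open>f k + m * r = f l\<close>: \<open>u\<close> represents the
    quotient of \<open>f l\<close> by \<open>f k\<close>.\<close>
  define u where "u = 1 + gg (f k) * r"
  have u: "zeval u z = zeval (f l) z / zeval (f k) z" if z: "z \<in> zroots B" for z
  proof -
    obtain w where "f k * gg (f k) - [:m:] = B * w" using gg[of "f k"] unfolding m_def by (elim dvdE)
    hence "zeval (f k * gg (f k) - [:m:]) z = 0" using z by (simp add: zroots_def)
    hence g: "zeval (f k) z * zeval (gg (f k)) z = of_int m" by simp
    have "zeval (f k) z * zeval u z
        = zeval (f k) z + (zeval (f k) z * zeval (gg (f k)) z) * zeval r z"
      by (simp add: u_def algebra_simps)
    also have "\<dots> = zeval (f l) z" unfolding g r by simp
    finally show ?thesis using nz[OF f z] by (simp add: field_simps)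
  qed
  show thesis
  proof (rule that[of u])
    have "(\<Prod>z\<in>zroots B. zeval u z) = (\<Prod>z\<in>zroots B. zeval (f l) z) / (\<Prod>z\<in>zroots B. zeval (f k) z)"
      by (simp add: u prod_dividef)
    also have "\<dots> = 1" using nm[of "f k"] nm[of "f l"] nml m0 by (simp add: m_def flip: nm)
    finally show "(\<Prod>z\<in>zroots B. zeval u z) = 1" .
    fix z assume z: "z \<in> zroots B" "z \<noteq> of_real \<alpha>"
    show "norm (zeval u z) < 1"
      using decr[OF kl(1), of z] z nz[OF f z(1), of k] u[OF z(1)]
      by (simp add: S'_def norm_divide)
  qed
qed

text \<open>These bounds make the logarithms of \<open>D\<close> nonpositive at the real eigenvalues
  other than \<alpha> and their total positive, as dominance of the entry at \<alpha> requires. The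
  idempotent \<open>e\<close> extends the unit \<open>u\<close> by the value 1 at the roots of
  \<open>W\<close>.\<close>

lemma exists_diagonally_dominant_polynomial:
  fixes \<alpha> :: real
  assumes M: "M \<in> carrier_mat N N" and cp: "char_poly M = B * W"
    and irr: "irreducible B" and sc: "strongly_coprime B W"
    and \<alpha>: "poly (of_int_poly B) \<alpha> = 0" and w: "w \<in> zroots B" "w \<notin> \<real>"
  defines "R \<equiv> {x::real. poly (of_int_poly (char_poly M)) x = 0}"
  shows "\<exists>D. mat_poly_eval D M \<in> SL_int N \<and> (\<forall>x\<in>R. poly (of_int_poly D) x > 0) \<and>
     (\<forall>x\<in>R - {\<alpha>}. poly (of_int_poly D) x \<le> 1) \<and> (\<Prod>x\<in>R. poly (of_int_poly D) x) > 1"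
proof -
  obtain e where e1: "\<And>z. z \<in> zroots B \<Longrightarrow> zeval e z = 1"
    and e0: "\<And>z. z \<in> zroots W \<Longrightarrow> zeval e z = 0" and disj: "zroots B \<inter> zroots W = {}"
    using strongly_coprime_idempotent[OF sc] by blast
  obtain u where u1: "(\<Prod>z\<in>zroots B. zeval u z) = 1"
    and u_lt: "\<And>z. z \<in> zroots B \<Longrightarrow> z \<noteq> of_real \<alpha> \<Longrightarrow> norm (zeval u z) < 1"
    using exists_unit_small_at_other_roots[OF irr \<alpha> integral_norm[OF M cp irr sc w(1)]] by blast
  have B0: "B \<noteq> 0" using irr by auto
  note fin = finite_zroots[OF B0]
  have u_nz: "zeval u z \<noteq> 0" if "z \<in> zroots B" for z
    using u1 fin that by (metis prod_zero_iff zero_neq_one)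
  define U where "U = 1 + e * (u - 1)"
  have UW: "zeval U z = 1" if "z \<in> zroots W" for z using e0[OF that] by (simp add: U_def)
  have UB: "zeval U z = zeval u z" if "z \<in> zroots B" for z using e1[OF that] by (simp add: U_def)
  \<comment> \<open>Squaring makes the values at the real eigenvalues positive and keeps the norm
    1.\<close>
  define D where "D = U ^ 2"
  have "of_int (Determinant.det (mat_poly_eval D M)) = (\<Prod>z\<in>zroots B. zeval D z)"
    using det_mat_poly_eval_eq_prod(1)[OF M cp irr disj, of D] UW by (simp add: D_def)
  also have "\<dots> = (\<Prod>z\<in>zroots B. zeval u z) ^ 2"
    using UB by (simp add: D_def prod_power_distrib)
  finally have "mat_poly_eval D M \<in> SL_int N" using M u1 by (simp add: SL_int_def)
  have R: "of_real x \<in> zroots B \<union> zroots W" if "x \<in> R" for x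
  proof -
    have "zeval (B * W) (of_real x) = 0" using that by (simp add: R_def cp zeval_of_real del: zeval_mult)
    thus ?thesis by (auto simp: zroots_def)
  qed
  have D_eq: "poly (of_int_poly D) x = norm (zeval U (of_real x)) ^ 2" for x :: real
    by (simp add: D_def zeval_of_real of_int_poly_hom.hom_power)
  have D_W: "poly (of_int_poly D) x = 1" if "of_real x \<in> zroots W" for x :: real
    using UW[OF that] by (simp add: D_eq)
  have D_B: "poly (of_int_poly D) x = norm (zeval u (of_real x)) ^ 2" if "of_real x \<in> zroots B" for x :: real
    using UB[OF that] by (simp add: D_eq)
  have D_pos: "poly (of_int_poly D) x > 0" if "x \<in> R" for x
    using R[OF that] D_W[of x] D_B[of x] u_nz by auto
  have D_le: "poly (of_int_poly D) x \<le> 1" if "x \<in> R - {\<alpha>}" for x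
    using R[of x] D_W[of x] D_B[of x] u_lt[of "of_real x"] that by (auto intro!: power_le_one)
  have RB: "x \<in> R" if "of_real x \<in> zroots B" for x
  proof -
    have "zeval (B * W) (of_real x) = 0" using that by (simp add: zroots_def)
    thus ?thesis by (simp add: R_def cp zeval_of_real del: zeval_mult)
  qed
  have "char_poly M \<noteq> 0" using degree_monic_char_poly[OF M] by auto
  hence finR: "finite R" unfolding R_def by (intro poly_roots_finite) simp
  define RB where "RB = {x. of_real x \<in> zroots B}"
  define S1 where "S1 = zroots B \<inter> \<real>"
  define S2 where "S2 = zroots B - \<real>"
  have S1: "S1 = of_real ` RB" by (auto simp: S1_def RB_def elim!: Reals_cases)
  have "(\<Prod>x\<in>R. poly (of_int_poly D) x) = (\<Prod>x\<in>RB. norm (zeval u (of_real x)) ^ 2)"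
    using R D_W D_B RB finR by (intro prod.mono_neutral_cong_right) (auto simp: RB_def)
  also have "\<dots> = (\<Prod>z\<in>S1. norm (zeval u z)) ^ 2"
    unfolding S1 by (subst prod.reindex) (auto simp: inj_on_def prod_power_distrib)
  \<comment> \<open>The absolute values of \<open>u\<close> multiply to 1 over all roots of
    \<open>B\<close>. The non-real ones are all less than 1, and \<open>w\<close> is among them, so
    the real ones must compensate.\<close>
  also have "(\<Prod>z\<in>S1. norm (zeval u z)) > 1"
  proof -
    have f: "finite S1" "finite S2" using fin by (auto simp: S1_def S2_def)
    have "(\<Prod>z\<in>S1. norm (zeval u z)) * (\<Prod>z\<in>S2. norm (zeval u z)) = (\<Prod>z\<in>zroots B. norm (zeval u z))"
      using f by (subst prod.union_disjoint[symmetric]) (auto simp: S1_def S2_def intro!: prod.cong)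
    also have "\<dots> = 1" using u1 by (simp add: prod_norm)
    finally have 1: "(\<Prod>z\<in>S1. norm (zeval u z)) * (\<Prod>z\<in>S2. norm (zeval u z)) = 1" .
    have "(\<Prod>z\<in>S2. norm (zeval u z)) < (\<Prod>z\<in>S2. 1)"
    proof (rule prod_mono_strict)
      have lt: "norm (zeval u z) < 1" if "z \<in> S2" for z
      proof -
        have "z \<noteq> of_real \<alpha>" using that by (auto simp: S2_def)
        thus ?thesis using that u_lt[of z] by (simp add: S2_def)
      qed
      show w2: "w \<in> S2" using w by (simp add: S2_def)
      show "norm (zeval u w) < 1" using lt[OF w2] .
      show "0 \<le> norm (zeval u z) \<and> norm (zeval u z) \<le> 1" if "z \<in> S2" for z
        using lt[OF that] by simp
    qed (use f in auto)
    moreover have "(\<Prod>z\<in>S1. norm (zeval u z)) > 0" using u_nz by (intro prod_pos) (auto simp: S1_def)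
    ultimately have "(\<Prod>z\<in>S1. norm (zeval u z)) * (\<Prod>z\<in>S2. norm (zeval u z)) < (\<Prod>z\<in>S1. norm (zeval u z)) * 1"
      by (intro mult_strict_left_mono) auto
    thus ?thesis using 1 by simp
  qed
  hence "(\<Prod>z\<in>S1. norm (zeval u z)) ^ 2 > 1" by (simp add: one_less_power)
  finally have "(\<Prod>x\<in>R. poly (of_int_poly D) x) > 1" by simp
  thus ?thesis using \<open>mat_poly_eval D M \<in> SL_int N\<close> D_pos D_le by blast
qed

section \<open>Diagonally dominant matrices\<close>

text \<open>At a coordinate \<open>i\<close> where \<open>x\<close> has its largest absolute value
  \<open>m\<close>, row \<open>i\<close> gives \<open>\<bar>v i i\<bar> * m \<le>
  (\<Sum>j\<in>{..<s} - {i}. \<bar>v i j\<bar>) * m\<close>, which contradicts dominance unless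
  \<open>m = 0\<close>.\<close>

lemma strictly_diagonally_dominant_inj:
  fixes v :: "nat \<Rightarrow> nat \<Rightarrow> real"
  assumes dom: "\<forall>i<s. (\<Sum>j\<in>{..<s} - {i}. \<bar>v i j\<bar>) < \<bar>v i i\<bar>"
    and ker: "\<forall>i<s. (\<Sum>j<s. v i j * x j) = 0" and j: "j < s"
  shows "x j = 0"
proof -
  define m where "m = Max ((\<lambda>j. \<bar>x j\<bar>) ` {..<s})"
  have "m \<in> (\<lambda>j. \<bar>x j\<bar>) ` {..<s}" unfolding m_def using j by (intro Max_in) auto
  then obtain i where i: "i < s" "m = \<bar>x i\<bar>" by auto
  have le: "\<bar>x k\<bar> \<le> m" if "k < s" for k unfolding m_def using that by (intro Max_ge) auto
  have "m = 0"
  proof (rule ccontr)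
    assume "m \<noteq> 0"
    hence m: "m > 0" using i(2) by simp
    have "v i i * x i = - (\<Sum>j\<in>{..<s} - {i}. v i j * x j)"
      using ker[rule_format, OF i(1)] i(1) by (simp add: sum.remove[of "{..<s}" i])
    hence "\<bar>v i i\<bar> * m = \<bar>\<Sum>j\<in>{..<s} - {i}. v i j * x j\<bar>"
      using i(2) by (metis abs_minus_cancel abs_mult)
    also have "\<dots> \<le> (\<Sum>j\<in>{..<s} - {i}. \<bar>v i j\<bar> * m)"
      by (rule order_trans[OF sum_abs]) (auto intro!: sum_mono mult_left_mono le simp: abs_mult)
    also have "\<dots> = (\<Sum>j\<in>{..<s} - {i}. \<bar>v i j\<bar>) * m" by (simp add: sum_distrib_right)
    also have "\<dots> < \<bar>v i i\<bar> * m" using dom i(1) m by simp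
    finally show False by simp
  qed
  thus ?thesis using le[OF j] by simp
qed

text \<open>A trivial kernel makes the square matrix \<open>V\<close> invertible on both sides. Of
  its inverse \<open>X\<close>, \<open>V * X = 1\<close> gives independence of the rows and
  \<open>X * V = 1\<close> gives spanning.\<close>

lemma strictly_diagonally_dominant_basis:
  assumes dom: "\<forall>i<s. (\<Sum>j\<in>{..<s} - {i}. \<bar>v i j\<bar>) < \<bar>v i i\<bar>"
  shows "is_basis_Rs s v"
proof -
  define V where "V = Matrix.mat s s (\<lambda>(i, j). v i j)"
  have V: "V \<in> carrier_mat s s" by (simp add: V_def)
  have "x = 0\<^sub>v s" if x: "x \<in> carrier_vec s" "V *\<^sub>v x = 0\<^sub>v s" for x
  proof -
    have "(\<Sum>j<s. v i j * vec_index x j) = 0" if "i < s" for i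
      using arg_cong[OF x(2), of "\<lambda>y. vec_index y i"] x(1) that
      by (simp add: V_def scalar_prod_def atLeast0LessThan)
    hence "vec_index x j = 0" if "j < s" for j
      using strictly_diagonally_dominant_inj[OF dom, of "\<lambda>j. vec_index x j"] that by blast
    thus ?thesis using x(1) by (intro eq_vecI) auto
  qed
  hence "Determinant.det V \<noteq> 0" using det_0_iff_vec_prod_zero_field[OF V] by auto
  from det_non_zero_imp_unit[OF V this, of "()"]
  obtain X where X: "X \<in> carrier_mat s s" "X * V = 1\<^sub>m s" "V * X = 1\<^sub>m s"
    by (auto simp: Units_def ring_mat_simps)
  define y where "y = (\<lambda>i j. X $$ (i, j))"
  have XV: "(\<Sum>k<s. y i k * v k j) = (if i = j then 1 else 0)" if "i < s" "j < s" for i j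
    using arg_cong[OF X(2), of "\<lambda>Y. Y $$ (i, j)"] X(1) V that
    by (simp add: V_def y_def scalar_prod_def atLeast0LessThan)
  have VX: "(\<Sum>k<s. v i k * y k j) = (if i = j then 1 else 0)" if "i < s" "j < s" for i j
    using arg_cong[OF X(3), of "\<lambda>Y. Y $$ (i, j)"] X(1) V that
    by (simp add: V_def y_def scalar_prod_def atLeast0LessThan)
  show ?thesis unfolding is_basis_Rs_def
  proof (intro conjI allI impI)
    fix c :: "nat \<Rightarrow> real" and i
    assume c: "\<forall>j<s. (\<Sum>i<s. c i * v i j) = 0" and i: "i < s"
    have "c i = (\<Sum>k<s. c k * (if k = i then 1 else 0))" using i by (simp add: if_distrib cong: if_cong)
    also have "\<dots> = (\<Sum>k<s. c k * (\<Sum>j<s. v k j * y j i))" using VX i by simp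
    also have "\<dots> = (\<Sum>j<s. (\<Sum>k<s. c k * v k j) * y j i)"
      by (simp add: sum_distrib_left sum_distrib_right mult.assoc) (rule sum.swap)
    also have "\<dots> = 0" using c by simp
    finally show "c i = 0" .
  next
    fix w :: "nat \<Rightarrow> real"
    have "(\<Sum>i<s. (\<Sum>k<s. w k * y k i) * v i j) = w j" if j: "j < s" for j
    proof -
      have "(\<Sum>i<s. (\<Sum>k<s. w k * y k i) * v i j) = (\<Sum>k<s. w k * (\<Sum>i<s. y k i * v i j))"
        by (simp add: sum_distrib_left sum_distrib_right mult.assoc) (rule sum.swap)
      also have "\<dots> = (\<Sum>k<s. w k * (if k = j then 1 else 0))" using XV j by simp
      also have "\<dots> = w j" using j by (simp add: if_distrib cong: if_cong)
      finally show ?thesis .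
    qed
    thus "\<exists>c. \<forall>j<s. (\<Sum>i<s. c i * v i j) = w j"
      by (intro exI[of _ "\<lambda>i. \<Sum>k<s. w k * y k i"] allI impI)
  qed
qed

text \<open>Needed because a Dirichlet family is tested against every enumeration of the real
  eigenvalues, while dominance holds for the one that indexes the family.\<close>

lemma is_basis_Rs_permute:
  assumes basis: "is_basis_Rs s v" and \<pi>: "bij_betw \<pi> {..<s} {..<s}"
  shows "is_basis_Rs s (\<lambda>i j. v i (\<pi> j))"
  unfolding is_basis_Rs_def
proof (intro conjI allI impI)
  fix c :: "nat \<Rightarrow> real" and i
  assume c: "\<forall>j<s. (\<Sum>i<s. c i * v i (\<pi> j)) = 0" and i: "i < s"
  have "(\<Sum>i<s. c i * v i j) = 0" if "j < s" for j
  proof -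
    have "j \<in> \<pi> ` {..<s}" using \<pi> that by (simp add: bij_betw_imp_surj_on)
    thus ?thesis using c by auto
  qed
  thus "c i = 0" using basis i unfolding is_basis_Rs_def by blast
next
  fix w :: "nat \<Rightarrow> real"
  obtain c where c: "\<forall>j<s. (\<Sum>i<s. c i * v i j) = w (inv_into {..<s} \<pi> j)"
    using spec[OF conjunct2[OF basis[unfolded is_basis_Rs_def]], of "\<lambda>j. w (inv_into {..<s} \<pi> j)"]
    by (elim exE)
  have "(\<Sum>i<s. c i * v i (\<pi> j)) = w j" if "j < s" for j
    using c that bij_betwE[OF \<pi>] bij_betw_inv_into_left[OF \<pi>] by auto
  thus "\<exists>c. \<forall>j<s. (\<Sum>i<s. c i * v i (\<pi> j)) = w j"
    by (intro exI[of _ c] allI impI)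
qed

lemma is_basis_Rs_cong:
  assumes "\<And>i j. i < s \<Longrightarrow> j < s \<Longrightarrow> v i j = w i j"
  shows "is_basis_Rs s v \<longleftrightarrow> is_basis_Rs s w"
proof -
  have "(\<Sum>i<s. c i * v i j) = (\<Sum>i<s. c i * w i j)" if "j < s" for c j
    using assms that by (intro sum.cong) auto
  thus ?thesis unfolding is_basis_Rs_def by simp
qed

section \<open>Existence of a Dirichlet family\<close>

theorem theorem4p13:
  fixes N :: nat and M :: "int mat"
  assumes "M \<in> SL_int N"
    and "type_J_poly (char_poly M)"
  shows "\<exists>D :: nat \<Rightarrow> int poly. dirichlet_family N M D"
proof -
  have M: "M \<in> carrier_mat N N" using assms(1) by (simp add: SL_int_def)
  define R where "R = {x::real. poly (of_int_poly (char_poly M)) x = 0}"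
  have R: "real_eigenvalues M = R"
    using eigenvalue_root_char_poly[of "map_mat real_of_int M" N] M
    by (simp add: real_eigenvalues_def R_def of_int_hom.char_poly_hom)
  have "char_poly M \<noteq> 0" using degree_monic_char_poly[OF M] by auto
  hence finR: "finite R" unfolding R_def by (intro poly_roots_finite) simp
  obtain k :: nat and B where C: "char_poly M = (\<Prod>i\<in>{0..k}. B i)"
    and B0: "\<And>x::real. poly (of_int_poly (B 0)) x \<noteq> 0"
    and B: "\<And>i. i \<in> {1..k} \<Longrightarrow> irreducible (B i) \<and>
        (\<exists>z. poly (map_poly complex_of_int (B i)) z = 0 \<and> z \<notin> \<real>)"
    and sc: "\<And>i j. i \<in> {0..k} \<Longrightarrow> j \<in> {0..k} \<Longrightarrow> i \<noteq> j \<Longrightarrow> strongly_coprime (B i) (B j)"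
    using assms(2) unfolding type_J_poly_def by blast
  have "\<exists>D. mat_poly_eval D M \<in> SL_int N \<and> (\<forall>x\<in>R. poly (of_int_poly D) x > 0) \<and>
     (\<forall>x\<in>R - {\<alpha>}. poly (of_int_poly D) x \<le> 1) \<and> (\<Prod>x\<in>R. poly (of_int_poly D) x) > 1"
    if \<alpha>: "\<alpha> \<in> R" for \<alpha>
  proof -
    have "zeval (char_poly M) (of_real \<alpha>) = 0" using \<alpha> by (simp add: R_def zeval_of_real)
    hence "(\<Prod>i\<in>{0..k}. zeval (B i) (of_real \<alpha>)) = 0" unfolding C zeval_prod .
    then obtain i where i: "i \<in> {0..k}" "zeval (B i) (of_real \<alpha>) = 0" by (auto simp: prod_zero_iff)
    hence i\<alpha>: "poly (of_int_poly (B i)) \<alpha> = 0" by (simp add: zeval_of_real)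
    hence "i \<noteq> 0" using B0 by metis
    hence "i \<in> {1..k}" using i by simp
    then obtain w where irr: "irreducible (B i)" and w: "w \<in> zroots (B i)" "w \<notin> \<real>"
      using B by (auto simp: zroots_def zeval_def)
    have "char_poly M = B i * (\<Prod>j\<in>{0..k} - {i}. B j)"
      unfolding C using i(1) by (intro prod.remove) auto
    moreover have "strongly_coprime (B i) (\<Prod>j\<in>{0..k} - {i}. B j)"
      using i(1) sc by (intro strongly_coprime_prod) auto
    ultimately show ?thesis
      using exists_diagonally_dominant_polynomial[OF M _ irr _ i\<alpha> w] unfolding R_def by blast
  qed
  then obtain E where E_SL: "\<And>\<alpha>. \<alpha> \<in> R \<Longrightarrow> mat_poly_eval (E \<alpha>) M \<in> SL_int N"
    and E_pos: "\<And>\<alpha> x. \<alpha> \<in> R \<Longrightarrow> x \<in> R \<Longrightarrow> poly (of_int_poly (E \<alpha>)) x > 0"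
    and E_le: "\<And>\<alpha> x. \<alpha> \<in> R \<Longrightarrow> x \<in> R \<Longrightarrow> x \<noteq> \<alpha> \<Longrightarrow> poly (of_int_poly (E \<alpha>)) x \<le> 1"
    and E_prod: "\<And>\<alpha>. \<alpha> \<in> R \<Longrightarrow> (\<Prod>x\<in>R. poly (of_int_poly (E \<alpha>)) x) > 1"
    by (metis DiffI singletonD)
  define s where "s = card R"
  \<comment> \<open>The polynomial of index \<open>i\<close> is the one built for the eigenvalue
    \<open>a i\<close>, which puts its dominant logarithm on the diagonal.\<close>
  obtain a where a: "bij_betw a {..<s} R"
    using ex_bij_betw_nat_finite[OF finR] by (auto simp: s_def atLeast0LessThan)
  have aR: "a i \<in> R" if "i < s" for i using bij_betwE[OF a] that by auto
  define v where "v = (\<lambda>i j. ln (poly (of_int_poly (E (a i))) (a j)))"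
  \<comment> \<open>Off-diagonal entries are nonpositive and row sums are positive, so the diagonal
    entry outweighs the absolute values of the rest of its row.\<close>
  have dom: "\<forall>i<s. (\<Sum>j\<in>{..<s} - {i}. \<bar>v i j\<bar>) < \<bar>v i i\<bar>"
  proof (intro allI impI)
    fix i assume i: "i < s"
    have le: "v i j \<le> 0" if "j \<in> {..<s} - {i}" for j
    proof -
      have "a j \<noteq> a i" using a that i by (auto simp: bij_betw_def inj_on_def)
      thus ?thesis using E_le[OF aR[OF i], of "a j"] E_pos[OF aR[OF i], of "a j"] aR[of j] that
        by (simp add: v_def)
    qed
    have "(\<Sum>j<s. v i j) = (\<Sum>x\<in>R. ln (poly (of_int_poly (E (a i))) x))"
      unfolding v_def by (rule sum.reindex_bij_betw[OF a])
    also have "\<dots> = ln (\<Prod>x\<in>R. poly (of_int_poly (E (a i))) x)"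
      using E_pos[OF aR[OF i]] finR by (intro ln_prod[symmetric]) (auto dest: less_imp_neq[OF E_pos[OF aR[OF i]]])
    also have "\<dots> > 0" using E_prod[OF aR[OF i]] by simp
    finally have "(\<Sum>j\<in>{..<s} - {i}. - v i j) < v i i"
      using i by (simp add: sum.remove[of "{..<s}" i] sum_negf)
    moreover have "(\<Sum>j\<in>{..<s} - {i}. \<bar>v i j\<bar>) = (\<Sum>j\<in>{..<s} - {i}. - v i j)"
      using le by (intro sum.cong) auto
    ultimately show "(\<Sum>j\<in>{..<s} - {i}. \<bar>v i j\<bar>) < \<bar>v i i\<bar>" by linarith
  qed
  have "is_basis_Rs s (\<lambda>i j. ln (poly (of_int_poly (E (a i))) (\<alpha> j)))" if \<alpha>: "bij_betw \<alpha> {..<s} R" for \<alpha>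
  proof -
    \<comment> \<open>The permutation of indices that carries the enumeration \<open>a\<close> to
      \<alpha>.\<close>
    define \<pi> where "\<pi> = inv_into {..<s} a \<circ> \<alpha>"
    have "bij_betw \<pi> {..<s} {..<s}"
      unfolding \<pi>_def using \<alpha> bij_betw_inv_into[OF a] by (rule bij_betw_trans)
    from is_basis_Rs_permute[OF strictly_diagonally_dominant_basis[OF dom] this]
    show ?thesis
    proof (subst is_basis_Rs_cong)
      fix i j assume "j < s"
      hence "\<alpha> j \<in> R" using bij_betwE[OF \<alpha>] by auto
      hence "a (\<pi> j) = \<alpha> j" using bij_betw_inv_into_right[OF a] by (simp add: \<pi>_def)
      thus "ln (poly (of_int_poly (E (a i))) (\<alpha> j)) = v i (\<pi> j)" by (simp add: v_def)
    qed
  qed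
  hence "dirichlet_family N M (\<lambda>i. E (a i))"
    unfolding dirichlet_family_def Let_def R s_def[symmetric] using E_SL E_pos aR by blast
  thus ?thesis by blast
qed

end
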